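(* Let $\mathcal B$ and $\mathcal O$ be two bounded (closed) convex polygons in $\mathbb{R}^2$, and let $V\in\mathbb{R}^{2\times M}$ and $O\in\mathbb{R}^{2\times N}$ be the matrices whose columns are all the vertices of $\mathcal B$ and of $\mathcal O$, respectively. Then $\mathcal B\cap\mathcal O=\emptyset$ if and only if there exist $\boldsymbol{\lambda}\in\mathbb{R}^2$ and $\mu\in\mathbb{R}$ such that $$\boldsymbol{\lambda}^\top V>\mu\boldsymbol{1}^\top,\qquad \boldsymbol{\lambda}^\top O<\mu\boldsymbol{1}^\top,\qquad \|\boldsymbol{\lambda}\|>0.$$
   Context: Inequalities between vectors are componentwise, and $\boldsymbol{1}=(1,\ldots,1)^\top$ is the all-ones vector of the appropriate length. A bounded convex polygon is a nonempty bounded set of the form $\{\boldsymbol{q}\in\mathbb{R}^2\mid C\boldsymbol{q}\le\boldsymbol{d}\}$ with $C\in\mathbb{R}^{M\times 2}$, $\boldsymbol{d}\in\mathbb{R}^M$. *)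

theory Defs
  imports "HOL-Analysis.Analysis"
begin

text \<open>The library order on vectors is componentwise for \<open>\<le>\<close>, but its \<open><\<close> only means
  \<open>\<le>\<close> and \<open>\<noteq>\<close>. A strict inequality between vectors here is strict in every component.\<close>

definition vec_less :: "real ^ 'n \<Rightarrow> real ^ 'n \<Rightarrow> bool"  (infix \<open><\<^sub>v\<close> 50)
  where "x <\<^sub>v y \<longleftrightarrow> (\<forall>i. x $ i < y $ i)"

end

theory Submission
  imports Defs
begin

text \<open>Disjoint compact convex sets can be strictly separated by a line, in particular their
  extreme points. Conversely, by Krein--Milman a polygon is the convex hull of its vertices, so
  a strict linear inequality on the vertices, whose solution set is a half-plane, extends to the
  whole polygon.\<close>

lemma polyhedron_matrix_inequality:
  fixes A :: "real ^ 'n ^ 'm" and b :: "real ^ 'm"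
  shows "polyhedron {x. A *v x \<le> b}"
proof -
  have "{x. A *v x \<le> b} = (\<Inter>i. {x. row i A \<bullet> x \<le> b $ i})"
    by (auto simp: less_eq_vec_def matrix_vector_mul_component row_def)
  then show ?thesis
    by (auto intro!: polyhedron_Inter polyhedron_halfspace_le)
qed

lemma vector_matrix_mult_component:
  fixes l :: "real ^ 'm" and A :: "real ^ 'n ^ 'm"
  shows "(l v* A) $ j = l \<bullet> column j A"
  by (simp add: vector_matrix_mult_def inner_vec_def column_def mult.commute)

text \<open>Phrased through the set \<open>columns A\<close>, so that the order and repetition of
  vertices in a matrix do not matter.\<close>

lemma less_vector_matrix_mult_iff:
  fixes l :: "real ^ 'm" and A :: "real ^ 'n ^ 'm"
  shows "\<mu> *\<^sub>R 1 <\<^sub>v l v* A \<longleftrightarrow> (\<forall>x \<in> columns A. \<mu> < l \<bullet> x)"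
    and "l v* A <\<^sub>v \<mu> *\<^sub>R 1 \<longleftrightarrow> (\<forall>x \<in> columns A. l \<bullet> x < \<mu>)"
  by (auto simp: vec_less_def vector_matrix_mult_component columns_def)

text \<open>In finite dimension \<open>S\<close> is the convex hull of its extreme points, without
  taking a closure. Hence \<open>T\<close> may be an open half-space, as strict inequalities
  require.\<close>

lemma compact_convex_subset_iff_extreme_points:
  fixes S T :: "'a::euclidean_space set"
  assumes "compact S" "convex S" "convex T"
  shows "S \<subseteq> T \<longleftrightarrow> {x. x extreme_point_of S} \<subseteq> T"
proof
  show "S \<subseteq> T" if "{x. x extreme_point_of S} \<subseteq> T"
    using that assms by (metis Krein_Milman_Minkowski hull_minimal)
qed (auto simp: extreme_point_of_def)

theorem proposition5:
  fixes B Obs :: "(real ^ 2) set"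
    and C\<^sub>B :: "real ^ 2 ^ 'k" and d\<^sub>B :: "real ^ 'k"
    and C\<^sub>O :: "real ^ 2 ^ 'l" and d\<^sub>O :: "real ^ 'l"
    and V :: "real ^ 'm ^ 2" and W :: "real ^ 'n ^ 2"
  assumes "B = {q. C\<^sub>B *v q \<le> d\<^sub>B}" and "B \<noteq> {}" and "bounded B"
    and "Obs = {q. C\<^sub>O *v q \<le> d\<^sub>O}" and "Obs \<noteq> {}" and "bounded Obs"
    and "columns V = {v. v extreme_point_of B}"
    and "columns W = {w. w extreme_point_of Obs}"
  shows "B \<inter> Obs = {} \<longleftrightarrow>
    (\<exists>(l :: real ^ 2) (\<mu> :: real).
       \<mu> *\<^sub>R 1 <\<^sub>v l v* V \<and> l v* W <\<^sub>v \<mu> *\<^sub>R 1 \<and> norm l > 0)"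
proof -
  have "polyhedron B" "polyhedron Obs"
    unfolding assms(1,4) by (rule polyhedron_matrix_inequality)+
  then have B: "compact B" "convex B" and O: "compact Obs" "convex Obs"
    using \<open>bounded B\<close> \<open>bounded Obs\<close>
    by (simp_all add: compact_eq_bounded_closed polyhedron_imp_closed polyhedron_imp_convex)
  \<comment> \<open>From here on the matrices give way to inclusions in opposite open
    half-planes.\<close>
  have V: "\<mu> *\<^sub>R 1 <\<^sub>v l v* V \<longleftrightarrow> B \<subseteq> {x. l \<bullet> x > \<mu>}" for l \<mu>
    using compact_convex_subset_iff_extreme_points[OF B convex_halfspace_gt] assms(7)
    by (auto simp: less_vector_matrix_mult_iff)
  have W: "l v* W <\<^sub>v \<mu> *\<^sub>R 1 \<longleftrightarrow> Obs \<subseteq> {x. l \<bullet> x < \<mu>}" for l \<mu>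
    using compact_convex_subset_iff_extreme_points[OF O convex_halfspace_lt] assms(8)
    by (auto simp: less_vector_matrix_mult_iff)
  show ?thesis
  proof
    assume "B \<inter> Obs = {}"
    \<comment> \<open>The separation theorem puts its first set on the lower side, so
      \<open>Obs\<close> comes first.\<close>
    then obtain l \<mu> where "\<forall>x\<in>Obs. l \<bullet> x < \<mu>" "\<forall>x\<in>B. l \<bullet> x > \<mu>"
      using separating_hyperplane_closed_compact[of Obs B] B O \<open>B \<noteq> {}\<close>
      by (auto simp: compact_imp_closed Int_commute)
    \<comment> \<open>If \<open>l = 0\<close>, a point of \<open>Obs\<close> would give
      \<open>0 < \<mu>\<close> and a point of \<open>B\<close> would give
      \<open>\<mu> < 0\<close>.\<close>
    moreover from this have "l \<noteq> 0"
      using \<open>B \<noteq> {}\<close> \<open>Obs \<noteq> {}\<close> by fastforce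
    ultimately show "\<exists>l \<mu>. \<mu> *\<^sub>R 1 <\<^sub>v l v* V \<and> l v* W <\<^sub>v \<mu> *\<^sub>R 1 \<and> norm l > 0"
      unfolding V W by (intro exI[of _ l] exI[of _ \<mu>]) auto
  next
    assume "\<exists>l \<mu>. \<mu> *\<^sub>R 1 <\<^sub>v l v* V \<and> l v* W <\<^sub>v \<mu> *\<^sub>R 1 \<and> norm l > 0"
    \<comment> \<open>A common point \<open>x\<close> would have \<open>l \<bullet> x\<close> both
      above and below \<open>\<mu>\<close>.\<close>
    then show "B \<inter> Obs = {}"
      unfolding V W by fastforce
  qed
qed

end
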